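(* Let $V>0$, let $\sigma>0$, and consider on the three-dimensional lattice $\mathbb{Z}^3$ the discrete nonlinear Schrödinger equation with a single nonlinear impurity at the origin, $$\mathrm{i}\,\frac{dC_n}{dt}(t)=V\sum_{m\in\mathcal{N}_n}C_m(t)-\chi\,\delta_{n,0}\,F(C_n(t)),\qquad n\in\mathbb{Z}^3,\ t\ge 0,\qquad C_n(0)=\delta_{n,0},$$ where $\mathcal{N}_n$ is the set of the $6$ nearest neighbours of $n$ in $\mathbb{Z}^3$, $\chi>0$ is the nonlinearity strength, and $F:\mathbb{C}\to\mathbb{C}$ is either the power nonlinearity $F(z)=|z|^{2\sigma}z$ or the saturable nonlinearity $F(z)=\dfrac{|z|^2z}{1+|z|^2}$. Then there exist critical values $\chi_{\mathrm{crit}}^{\mathrm{pow}}>0$ (for the power nonlinearity) and $\chi_{\mathrm{crit}}^{\mathrm{sat}}>0$ (for the saturable nonlinearity) such that: (a) if $F$ is the power nonlinearity and $0<\chi<\chi_{\mathrm{crit}}^{\mathrm{pow}}$, or if $F$ is the saturable nonlinearity and $0<\chi<\chi_{\mathrm{crit}}^{\mathrm{sat}}$, then the solution satisfies $\lim_{t\to\infty}|C_0(t)|=0$, where $C_0(t)=C_{(0,0,0)}(t)$; (b) $\chi_{\mathrm{crit}}^{\mathrm{pow}}<\chi_{\mathrm{crit}}^{\mathrm{sat}}$.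
   Context: Here $\delta_{n,0}$ equals $1$ if $n=(0,0,0)$ and $0$ otherwise. The critical values may depend on $V$, and $\chi_{\mathrm{crit}}^{\mathrm{pow}}$ may also depend on $\sigma$. "The solution" means the unique global solution $t\mapsto (C_n(t))_{n\in\mathbb{Z}^3}$ of class $C([0,\infty),\ell^2(\mathbb{Z}^3))$ with the given initial condition; it conserves the norm, $\sum_{n}|C_n(t)|^2=1$ for all $t\ge 0$. For these couplings the value at the origin satisfies the integral equation $C_0(t)=J_0(2Vt)^3+\mathrm{i}\chi\int_0^tJ_0(2V(t-s))^3F(C_0(s))\,ds$, where $J_0$ is the Bessel function of the first kind of order $0$. *)

theory Defs
  imports "HOL-Analysis.Analysis"
begin

type_synonym site = "int \<times> int \<times> int"

fun neighbours :: "site \<Rightarrow> site set" where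
  "neighbours (x, y, z) =
     {(x + 1, y, z), (x - 1, y, z), (x, y + 1, z), (x, y - 1, z), (x, y, z + 1), (x, y, z - 1)}"

definition delta0 :: "site \<Rightarrow> complex" where
  "delta0 n = (if n = (0, 0, 0) then 1 else 0)"

definition F_pow :: "real \<Rightarrow> complex \<Rightarrow> complex" where
  "F_pow \<sigma> z = of_real (cmod z powr (2 * \<sigma>)) * z"

definition F_sat :: "complex \<Rightarrow> complex" where
  "F_sat z = of_real ((cmod z)\<^sup>2) * z / of_real (1 + (cmod z)\<^sup>2)"

definition in_l2 :: "(site \<Rightarrow> complex) \<Rightarrow> bool" where
  "in_l2 u \<longleftrightarrow> (\<lambda>n. (cmod (u n))\<^sup>2) summable_on UNIV"

text \<open>\<open>infsum\<close> is 0 on non-summable families, so this is the norm of \<open>u\<close> only if \<open>in_l2 u\<close>.\<close>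

definition l2_norm :: "(site \<Rightarrow> complex) \<Rightarrow> real" where
  "l2_norm u = sqrt (\<Sum>\<^sub>\<infinity>n. (cmod (u n))\<^sup>2)"

definition l2_continuous_on :: "real set \<Rightarrow> (real \<Rightarrow> site \<Rightarrow> complex) \<Rightarrow> bool" where
  "l2_continuous_on T C \<longleftrightarrow>
     (\<forall>t\<in>T. in_l2 (C t)) \<and>
     (\<forall>t\<in>T. ((\<lambda>s. l2_norm (\<lambda>n. C s n - C t n)) \<longlongrightarrow> 0) (at t within T))"

text \<open>
  \<open>C t n\<close> is the amplitude at site \<open>n\<close> and time \<open>t\<close>; its values for \<open>t < 0\<close> are irrelevant.
  The derivative is one-sided at \<open>t = 0\<close>.
\<close>

definition dnls_solution ::
  "real \<Rightarrow> real \<Rightarrow> (complex \<Rightarrow> complex) \<Rightarrow> (real \<Rightarrow> site \<Rightarrow> complex) \<Rightarrow> bool" where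
  "dnls_solution V chi F C \<longleftrightarrow>
     l2_continuous_on {0..} C \<and>
     (\<forall>n. C 0 n = delta0 n) \<and>
     (\<forall>n. \<forall>t\<ge>0. \<exists>D. ((\<lambda>s. C s n) has_vector_derivative D) (at t within {0..}) \<and>
        \<i> * D = of_real V * (\<Sum>m\<in>neighbours n. C t m) - of_real chi * delta0 n * F (C t n))"

end

theory Submission
  imports Defs
begin

text \<open>
  Green's function of the linear lattice equation is the product over the three coordinates of
  \<open>(- \<i>) ^ \<bar>n\<bar> * J_\<bar>n\<bar> (2 V t)\<close>. Pairing it with the solution over a finite box, the boundary terms vanish
  as the box grows because \<open>J_n\<close> decays faster than exponentially in \<open>n\<close>; this yields Duhamel's formula
  at the origin with kernel \<open>J_0 (2 V t) ^ 3\<close>. A decreasing energy of Bessel's equation gives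
  \<open>\<bar>J_0 (2 V t)\<bar> \<le> c / sqrt (1 + t)\<close>, so the kernel is at most \<open>A * k t\<close> for
  \<open>k t = (1 + t) powr (- 3 / 2)\<close> and \<open>A = c ^ 3\<close>, where \<open>k\<close> is integrable and whose convolution with itself is at most \<open>12 * k t\<close>. A continuity argument then shows that
  \<open>cmod (C t (0, 0, 0)) \<le> 2 * A * k t\<close> persists for all times if the coupling is small. The
  threshold obtained this way is not optimal, so the one for the power nonlinearity can be chosen
  below the one for the saturable nonlinearity.
\<close>

section \<open>Bessel functions\<close>

definition bessel_coeff :: "nat \<Rightarrow> nat \<Rightarrow> real" where
  "bessel_coeff n k = (-1) ^ k / (fact k * fact (k + n))"

text \<open>At \<open>y = z^2\<close> this is J_n (2 z) / z^n, the Bessel-Clifford function at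
  \<open>- y\<close>. Splitting off \<open>z ^ n\<close> leaves a power series in \<open>y\<close>
  that can be differentiated termwise.\<close>

definition bessel_ser :: "nat \<Rightarrow> real \<Rightarrow> real" where
  "bessel_ser n y = (\<Sum>k. bessel_coeff n k * y ^ k)"

text \<open>With this normalisation \<open>bessel n z\<close> is \<open>J_n (2 * z)\<close>.\<close>

definition bessel :: "nat \<Rightarrow> real \<Rightarrow> real" where
  "bessel n z = z ^ n * bessel_ser n (z\<^sup>2)"

text \<open>Bounding (k + n)! below by n! pulls 1 / n! out of the exponential series. This factor
  later beats the growth of the boxes.\<close>

lemma bessel_term_bound: "norm (bessel_coeff n k * y ^ k) \<le> (inverse (fact k) * \<bar>y\<bar> ^ k) / fact n"
proof -
  have "(fact n :: real) \<le> fact (k + n)" by (rule fact_mono) simp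
  hence "1 / (fact k * fact (k + n)) \<le> 1 / (fact k * fact n :: real)"
    by (intro divide_left_mono mult_left_mono) auto
  hence "1 / (fact k * fact (k + n)) * \<bar>y\<bar> ^ k \<le> 1 / (fact k * fact n :: real) * \<bar>y\<bar> ^ k"
    by (intro mult_right_mono) auto
  thus ?thesis by (simp add: bessel_coeff_def abs_mult power_abs divide_simps)
qed

lemma summable_norm_bessel: "summable (\<lambda>k. norm (bessel_coeff n k * y ^ k))"
  by (rule summable_comparison_test'[where N = 0, OF summable_divide[OF summable_exp[of "\<bar>y\<bar>"], of "fact n"]])
     (use bessel_term_bound in auto)

lemma summable_bessel: "summable (\<lambda>k. bessel_coeff n k * y ^ k)"
  using summable_norm_bessel by (rule summable_norm_cancel)

lemma bessel_ser_bound: "\<bar>bessel_ser n y\<bar> \<le> exp \<bar>y\<bar> / fact n"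
proof -
  have s: "summable (\<lambda>k. (inverse (fact k) * \<bar>y\<bar> ^ k) / fact n)"
    by (intro summable_divide summable_exp)
  have "\<bar>bessel_ser n y\<bar> \<le> (\<Sum>k. norm (bessel_coeff n k * y ^ k))"
    unfolding bessel_ser_def using summable_norm[OF summable_norm_bessel] by simp
  also have "\<dots> \<le> (\<Sum>k. (inverse (fact k) * \<bar>y\<bar> ^ k) / fact n)"
    by (intro suminf_le bessel_term_bound summable_norm_bessel s)
  also have "\<dots> = exp \<bar>y\<bar> / fact n"
    using suminf_divide[OF summable_exp[of "\<bar>y\<bar>"], of "fact n"] by (simp add: exp_def divide_inverse)
  finally show ?thesis .
qed

lemma DERIV_bessel_ser: "(bessel_ser n has_real_derivative - bessel_ser (Suc n) y) (at y)"
proof -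
  have "diffs (bessel_coeff n) k = - bessel_coeff (Suc n) k" for k
    by (simp add: diffs_def bessel_coeff_def divide_simps)
  moreover have "((\<lambda>x. \<Sum>k. bessel_coeff n k * x ^ k) has_real_derivative
      (\<Sum>k. diffs (bessel_coeff n) k * y ^ k)) (at y)"
    by (rule termdiffs_strong_converges_everywhere[OF summable_bessel])
  ultimately show ?thesis
    using suminf_minus[OF summable_bessel[of "Suc n" y]] by (simp add: bessel_ser_def[abs_def])
qed

text \<open>This is 2 (n + 1) J_{n+1} (x) / x = J_n (x) + J_{n+2} (x) at x = 2 z. The difference
  \<open>d\<close> of the two series has no constant term, and shifting its index by one gives the
  coefficients of order n + 2.\<close>

lemma bessel_ser_rec:
  "bessel_ser n y = (real n + 1) * bessel_ser (Suc n) y - y * bessel_ser (Suc (Suc n)) y"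
proof -
  define d where "d k = (real n + 1) * (bessel_coeff (Suc n) k * y ^ k) - bessel_coeff n k * y ^ k" for k
  have sd: "summable d" unfolding d_def
    by (intro summable_diff summable_mult summable_bessel)
  have d0: "d 0 = 0" by (simp add: d_def bessel_coeff_def divide_simps)
  have "(real n + 1) * bessel_coeff (Suc n) (Suc k) - bessel_coeff n (Suc k)
          = bessel_coeff (Suc (Suc n)) k" for k
  proof -
    have f: "(fact (Suc k + Suc n) :: real) = (real k + real n + 2) * fact (Suc k + n)"
      by (simp add: algebra_simps)
    have f': "(fact (k + Suc (Suc n)) :: real) = (real k + real n + 2) * fact (Suc k + n)"
      by (simp add: algebra_simps)
    have p: "real k + real n + 2 > 0" by simp
    have q: "(fact (Suc k + n) :: real) > 0" by simp
    show ?thesis unfolding bessel_coeff_def f f' fact_Suc[of k]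
      using p q by (simp add: divide_simps del: fact_Suc add_Suc) (simp add: algebra_simps del: fact_Suc add_Suc)
  qed
  hence dS: "d (Suc k) = y * (bessel_coeff (Suc (Suc n)) k * y ^ k)" for k
    by (simp add: d_def algebra_simps)
  have "(\<Sum>k. d k) = (\<Sum>k. d (Suc k))" using suminf_split_head[OF sd] d0 by simp
  also have "\<dots> = y * bessel_ser (Suc (Suc n)) y"
    unfolding dS bessel_ser_def by (rule suminf_mult[OF summable_bessel])
  also have "(\<Sum>k. d k) = (real n + 1) * bessel_ser (Suc n) y - bessel_ser n y"
    unfolding d_def bessel_ser_def
    by (subst suminf_diff[symmetric]) (auto intro!: summable_mult summable_bessel simp: suminf_mult[OF summable_bessel])
  finally show ?thesis by simp
qed

lemma DERIV_bessel_0: "(bessel 0 has_real_derivative - 2 * bessel 1 z) (at z within S)"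
proof -
  have "((\<lambda>z. bessel_ser 0 (z\<^sup>2)) has_real_derivative - bessel_ser (Suc 0) (z\<^sup>2) * (2 * z)) (at z)"
    by (rule DERIV_chain2[OF DERIV_bessel_ser]) (auto intro!: derivative_eq_intros)
  from has_field_derivative_at_within[OF this] show ?thesis
    by (simp add: bessel_def[abs_def] mult_ac)
qed

text \<open>The classical rule 2 J_n' = J_{n-1} - J_{n+1}, where the argument 2 z absorbs the factor
  2. Up to phases it is the hopping equation on a line.\<close>

lemma DERIV_bessel_Suc:
  "(bessel (Suc n) has_real_derivative bessel n z - bessel (Suc (Suc n)) z) (at z within S)"
proof -
  have "((\<lambda>z. z ^ Suc n * bessel_ser (Suc n) (z\<^sup>2)) has_real_derivative
      (real n + 1) * z ^ n * bessel_ser (Suc n) (z\<^sup>2)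
      + z ^ Suc n * (- bessel_ser (Suc (Suc n)) (z\<^sup>2) * (2 * z))) (at z)"
    by (rule derivative_eq_intros DERIV_chain2[OF DERIV_bessel_ser] refl)+ (auto simp: algebra_simps)
  also have "(real n + 1) * z ^ n * bessel_ser (Suc n) (z\<^sup>2)
      + z ^ Suc n * (- bessel_ser (Suc (Suc n)) (z\<^sup>2) * (2 * z)) = bessel n z - bessel (Suc (Suc n)) z"
    unfolding bessel_def bessel_ser_rec[of n "z\<^sup>2"] by (simp add: algebra_simps power2_eq_square)
  finally show ?thesis
    unfolding bessel_def[abs_def] by (rule has_field_derivative_at_within)
qed

lemma bessel_rec_1: "bessel 1 z = z * (bessel 0 z + bessel 2 z)"
  using bessel_ser_rec[of 0 "z\<^sup>2"] by (simp add: bessel_def algebra_simps power2_eq_square numeral_2_eq_2)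

lemma bessel_bound: "\<bar>bessel n z\<bar> \<le> \<bar>z\<bar> ^ n / fact n * exp (z\<^sup>2)"
  using mult_left_mono[OF bessel_ser_bound[of n "z\<^sup>2"], of "\<bar>z\<bar> ^ n"]
  by (simp add: bessel_def abs_mult power_abs)


text \<open>
  The function \<open>u x = sqrt x * J_0 x\<close> satisfies \<open>u'' + (1 + 1 / (4 * x\<^sup>2)) * u = 0\<close>; this is
  \<open>u'\<^sup>2 + (1 + 1 / (4 * x\<^sup>2)) * u\<^sup>2\<close> at \<open>x = 2 * z\<close>.
\<close>

definition bessel_energy :: "real \<Rightarrow> real" where
  "bessel_energy z = 2 * z * ((bessel 0 z)\<^sup>2 + (bessel 1 z)\<^sup>2) - bessel 0 z * bessel 1 z + (bessel 0 z)\<^sup>2 / (4 * z)"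

text \<open>If u'' = - q u with q = 1 + 1 / (4 x^2), then the energy u'^2 + q u^2 has derivative q'
  u^2, and q' is negative.\<close>

lemma DERIV_bessel_energy:
  assumes "0 < z"
  shows "(bessel_energy has_real_derivative - (bessel 0 z)\<^sup>2 / (4 * z\<^sup>2)) (at z)"
proof -
  define a b where "a = bessel 0 z" and "b = bessel 1 z"
  \<comment> \<open>The recurrence eliminates J_2, so that only J_0 and J_1 occur in the
    derivatives.\<close>
  have D1: "(bessel 1 has_real_derivative 2 * a - b / z) (at z)"
    using DERIV_bessel_Suc[of 0 z UNIV] bessel_rec_1[of z] assms
    by (simp add: a_def b_def numeral_2_eq_2 divide_simps)
  have D0: "(bessel 0 has_real_derivative - 2 * b) (at z)"
    using DERIV_bessel_0[of z UNIV] by (simp add: b_def)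
  have "(bessel_energy has_real_derivative
     (2 * (a\<^sup>2 + b\<^sup>2) + 2 * z * (2 * a * (-2 * b) + 2 * b * (2 * a - b / z))
      - (-2 * b * b + a * (2 * a - b / z)) + (2 * a * (-2 * b) * (4 * z) - a\<^sup>2 * 4) / (4 * z)\<^sup>2)) (at z)"
    unfolding bessel_energy_def[abs_def]
    by (rule derivative_eq_intros D0 D1 refl)+
       (use assms in \<open>auto simp: a_def b_def power2_eq_square algebra_simps\<close>)
  also have "(2 * (a\<^sup>2 + b\<^sup>2) + 2 * z * (2 * a * (-2 * b) + 2 * b * (2 * a - b / z))
      - (-2 * b * b + a * (2 * a - b / z)) + (2 * a * (-2 * b) * (4 * z) - a\<^sup>2 * 4) / (4 * z)\<^sup>2)
      = - a\<^sup>2 / (4 * z\<^sup>2)"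
    using assms by (simp add: field_simps power2_eq_square)
  finally show ?thesis by (simp add: a_def)
qed

text \<open>The left side is u^2. What remains of the energy is u'^2 + u^2 / (4 x^2), and these are
  the two squares in the proof.\<close>

lemma bessel_energy_ge:
  assumes "0 < z"
  shows "2 * z * (bessel 0 z)\<^sup>2 \<le> bessel_energy z"
proof -
  have "bessel_energy z - 2 * z * (bessel 0 z)\<^sup>2 =
     (4 * z * bessel 1 z - bessel 0 z)\<^sup>2 / (8 * z) + (bessel 0 z)\<^sup>2 / (8 * z)"
    using assms by (simp add: bessel_energy_def field_simps power2_eq_square)
  moreover have "\<dots> \<ge> 0" using assms by simp
  ultimately show ?thesis by linarith
qed

text \<open>The energy decreases. It blows up as \<open>z\<close> tends to 0 from above, hence the
  comparison with its value at 1.\<close>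

lemma bessel_0_sq_bound:
  assumes "1 \<le> z"
  shows "2 * z * (bessel 0 z)\<^sup>2 \<le> bessel_energy 1"
proof -
  have "bessel_energy z \<le> bessel_energy 1"
  proof (rule DERIV_nonpos_imp_nonincreasing[OF assms])
    fix x :: real assume "1 \<le> x"
    thus "\<exists>y. (bessel_energy has_real_derivative y) (at x) \<and> y \<le> 0"
      by (intro exI[of _ "- (bessel 0 x)\<^sup>2 / (4 * x\<^sup>2)"] conjI DERIV_bessel_energy) auto
  qed
  with bessel_energy_ge[of z] assms show ?thesis by linarith
qed

section \<open>Green's function on the lattice\<close>

text \<open>The phases turn the difference of neighbours in \<open>DERIV_bessel_Suc\<close> into a
  sum. Taking \<open>\<bar>n\<bar>\<close> agrees with J_{-n} = (-1)^n J_n, because the phases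
  absorb the sign.\<close>

definition green1 :: "real \<Rightarrow> int \<Rightarrow> real \<Rightarrow> complex" where
  "green1 V n t = (- \<i>) ^ nat \<bar>n\<bar> * of_real (bessel (nat \<bar>n\<bar>) (V * t))"

fun green :: "real \<Rightarrow> site \<Rightarrow> real \<Rightarrow> complex" where
  "green V (x, y, z) t = green1 V x t * green1 V y t * green1 V z t"

lemma green1_uminus: "green1 V (- n) = green1 V n"
  by (simp add: green1_def[abs_def])

lemma bessel_at_0: "bessel n 0 = (if n = 0 then 1 else 0)"
  using powser_zero[of "bessel_coeff n"] by (simp add: bessel_def bessel_ser_def bessel_coeff_def)

lemma green_at_0: "green V n 0 = delta0 n"
  by (cases n) (auto simp: green1_def bessel_at_0 delta0_def)

lemma green1_deriv_nat:
  "(green1 V (int n) has_vector_derivative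
     - \<i> * of_real V * (green1 V (int n - 1) t + green1 V (int n + 1) t)) (at t within S)"
proof -
  have chain: "((\<lambda>t. bessel n (V * t)) has_real_derivative D * V) (at t within S)"
    if "(bessel n has_real_derivative D) (at (V * t))" for D
    by (rule DERIV_chain2[of "bessel n" D "\<lambda>t. V * t", OF that]) (auto intro!: derivative_eq_intros)
  have cr: "(green1 V (int n) has_vector_derivative (- \<i>) ^ n * of_real (D * V)) (at t within S)"
    if "(bessel n has_real_derivative D) (at (V * t))" for D
    using has_vector_derivative_mult_right[OF bounded_linear.has_vector_derivative[OF bounded_linear_of_real
        chain[OF that, unfolded has_real_derivative_iff_has_vector_derivative]], of "(- \<i>) ^ n"]
    by (simp add: green1_def[abs_def])
  show ?thesis
  proof (cases n)
    \<comment> \<open>Both neighbours of 0 carry the same value, which accounts for the factor 2 in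
      \<open>DERIV_bessel_0\<close>.\<close>
    case 0
    with cr[unfolded 0, OF DERIV_bessel_0] show ?thesis
      by (simp add: green1_def algebra_simps)
  next
    case (Suc k)
    have [simp]: "nat \<bar>int k + 1 + 1\<bar> = Suc (Suc k)" "nat (int k + 2) = Suc (Suc k)" by simp_all
    from cr[unfolded Suc, OF DERIV_bessel_Suc] show ?thesis
      by (simp add: Suc green1_def algebra_simps)
  qed
qed

lemma green1_deriv:
  "(green1 V n has_vector_derivative
     - \<i> * of_real V * (green1 V (n - 1) t + green1 V (n + 1) t)) (at t within S)"
proof (cases "n \<ge> 0")
  case True
  then show ?thesis using green1_deriv_nat[of V "nat n" t S] by simp
next
  case False
  have [simp]: "green1 V (- n - 1) = green1 V (n + 1)" "green1 V (- n + 1) = green1 V (n - 1)"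
    "green1 V (1 - n) = green1 V (n - 1)"
    using green1_uminus[of V "n + 1"] green1_uminus[of V "n - 1"] by simp_all
  from False show ?thesis
    using green1_deriv_nat[of V "nat (- n)" t S] by (simp add: green1_uminus add.commute)
qed

text \<open>The product rule varies one coordinate at a time, and each neighbour differs from
  \<open>n\<close> in exactly one coordinate.\<close>

lemma green_deriv:
  "(green V n has_vector_derivative - \<i> * of_real V * (\<Sum>m\<in>neighbours n. green V m t)) (at t within S)"
proof (cases n)
  case (fields x y z)
  have "((\<lambda>t. green1 V x t * green1 V y t * green1 V z t) has_vector_derivative
     - \<i> * of_real V * (\<Sum>m\<in>neighbours n. green V m t)) (at t within S)"
    by (rule has_vector_derivative_eq_rhs[OF has_vector_derivative_mult[OF has_vector_derivative_mult]])
       (rule green1_deriv | simp add: fields algebra_simps)+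
  thus ?thesis by (simp add: fields green.simps[abs_def])
qed

lemma green1_bound:
  assumes "\<bar>V * \<tau>\<bar> \<le> X"
  shows "cmod (green1 V n \<tau>) \<le> X ^ nat \<bar>n\<bar> / fact (nat \<bar>n\<bar>) * exp (X\<^sup>2)"
proof -
  have "(V * \<tau>)\<^sup>2 \<le> X\<^sup>2" using assms by (simp add: abs_le_square_iff[symmetric])
  hence "\<bar>V * \<tau>\<bar> ^ nat \<bar>n\<bar> / fact (nat \<bar>n\<bar>) * exp ((V * \<tau>)\<^sup>2) \<le> X ^ nat \<bar>n\<bar> / fact (nat \<bar>n\<bar>) * exp (X\<^sup>2)"
    using assms by (intro mult_mono divide_right_mono power_mono) auto
  with bessel_bound[of "nat \<bar>n\<bar>" "V * \<tau>"] show ?thesis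
    by (simp add: green1_def norm_mult norm_power)
qed

lemma power_over_fact_le_exp:
  fixes x :: real
  assumes "0 \<le> x"
  shows "x ^ n / fact n \<le> exp x"
proof -
  have "(\<Sum>k\<in>{n}. inverse (fact k) * x ^ k) \<le> (\<Sum>k. inverse (fact k) * x ^ k)"
    by (rule sum_le_suminf[OF summable_exp]) (use assms in auto)
  thus ?thesis by (simp add: exp_def divide_inverse mult.commute)
qed

text \<open>The factor whose coordinate is \<open>k\<close> or \<open>- k\<close> supplies the decay
  \<open>X ^ k / fact k\<close>. The other two are bounded independently of their coordinates, since
  \<open>x ^ n / fact n \<le> exp x\<close>.\<close>

lemma green_bound:
  assumes "\<bar>V * \<tau>\<bar> \<le> X" and "\<bar>x\<bar> = int k \<or> \<bar>y\<bar> = int k \<or> \<bar>z\<bar> = int k"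
  shows "cmod (green V (x, y, z) \<tau>) \<le> X ^ k / fact k * exp (X\<^sup>2) * (exp X * exp (X\<^sup>2))\<^sup>2"
proof -
  have X: "0 \<le> X" using assms(1) by linarith
  define c where "c = exp X * exp (X\<^sup>2)"
  define p where "p = X ^ k / fact k * exp (X\<^sup>2)"
  have c: "cmod (green1 V n \<tau>) \<le> c" for n
    unfolding c_def using power_over_fact_le_exp[OF X, of "nat \<bar>n\<bar>"]
    by (intro order_trans[OF green1_bound[OF assms(1)]] mult_right_mono) auto
  have p: "cmod (green1 V n \<tau>) \<le> p" if "\<bar>n\<bar> = int k" for n
    using green1_bound[OF assms(1), of n] that by (simp add: p_def)
  have [simp]: "c \<ge> 0" "p \<ge> 0" using X by (auto simp: c_def p_def)
  have "cmod (green1 V x \<tau>) * cmod (green1 V y \<tau>) * cmod (green1 V z \<tau>) \<le> p * c * c"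
    using assms(2)
  proof (elim disjE)
    assume "\<bar>x\<bar> = int k" from p[OF this] c[of y] c[of z] show ?thesis by (intro mult_mono) auto
  next
    assume "\<bar>y\<bar> = int k"
    have "cmod (green1 V x \<tau>) * cmod (green1 V y \<tau>) * cmod (green1 V z \<tau>) \<le> c * p * c"
      using p[OF \<open>\<bar>y\<bar> = int k\<close>] c[of x] c[of z] by (intro mult_mono) auto
    thus ?thesis by (simp add: mult_ac)
  next
    assume "\<bar>z\<bar> = int k"
    have "cmod (green1 V x \<tau>) * cmod (green1 V y \<tau>) * cmod (green1 V z \<tau>) \<le> c * c * p"
      using p[OF \<open>\<bar>z\<bar> = int k\<close>] c[of x] c[of y] by (intro mult_mono) auto
    thus ?thesis by (simp add: mult_ac)
  qed
  thus ?thesis by (simp add: norm_mult p_def c_def power2_eq_square mult_ac)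
qed

section \<open>Finite boxes and their boundary edges\<close>

definition box :: "nat \<Rightarrow> site set" where
  "box N = {- int N..int N} \<times> {- int N..int N} \<times> {- int N..int N}"

lemma finite_box: "finite (box N)" and card_box: "card (box N) = (2 * N + 1) ^ 3"
proof -
  have "nat (1 + int N + int N) = 2 * N + 1" by simp
  thus "card (box N) = (2 * N + 1) ^ 3"
    by (simp add: box_def card_cartesian_product power3_eq_cube)
qed (simp add: box_def)

lemma zero_in_box: "(0, 0, 0) \<in> box N"
  by (simp add: box_def)

lemma neighbours_sym: "m \<in> neighbours n \<longleftrightarrow> n \<in> neighbours m"
  by (cases m; cases n) auto

lemma finite_neighbours: "finite (neighbours n)" and card_neighbours: "card (neighbours n) = 6"
  by (cases n; simp)+

text \<open>An edge leaving the box starts at a site with a coordinate of modulus \<open>N\<close>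
  and ends at one with a coordinate of modulus \<open>N + 1\<close>, so Green's function is small at
  both ends.\<close>

lemma box_boundary:
  assumes "n \<in> box N" "m \<in> neighbours n" "m \<notin> box N" "\<bar>V * \<tau>\<bar> \<le> X"
  shows "cmod (green V n \<tau>) \<le> X ^ N / fact N * exp (X\<^sup>2) * (exp X * exp (X\<^sup>2))\<^sup>2"
    and "cmod (green V m \<tau>) \<le> X ^ Suc N / fact (Suc N) * exp (X\<^sup>2) * (exp X * exp (X\<^sup>2))\<^sup>2"
proof -
  obtain x y z where n: "n = (x, y, z)" by (cases n)
  obtain x' y' z' where m: "m = (x', y', z')" by (cases m)
  have "\<bar>x\<bar> = int N \<or> \<bar>y\<bar> = int N \<or> \<bar>z\<bar> = int N"
    and "\<bar>x'\<bar> = int (Suc N) \<or> \<bar>y'\<bar> = int (Suc N) \<or> \<bar>z'\<bar> = int (Suc N)"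
    using assms(1-3) unfolding n m box_def by auto
  thus "cmod (green V n \<tau>) \<le> X ^ N / fact N * exp (X\<^sup>2) * (exp X * exp (X\<^sup>2))\<^sup>2"
    "cmod (green V m \<tau>) \<le> X ^ Suc N / fact (Suc N) * exp (X\<^sup>2) * (exp X * exp (X\<^sup>2))\<^sup>2"
    unfolding n m using green_bound[OF assms(4)] by blast+
qed

text \<open>Green's second identity on a graph: the summand is antisymmetric in \<open>n\<close> and
  \<open>m\<close> while adjacency is symmetric, so the edges inside \<open>B\<close> contribute
  \<open>S = - S\<close>.\<close>

lemma discrete_green_identity:
  fixes a c :: "site \<Rightarrow> complex"
  assumes "finite B"
  shows "(\<Sum>n\<in>B. \<Sum>m\<in>neighbours n. a m * c n - a n * c m) =
         (\<Sum>n\<in>B. \<Sum>m\<in>neighbours n - B. a m * c n - a n * c m)"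
proof -
  define f where "f n m = a m * c n - a n * c m" for n m
  define S where "S = (\<Sum>n\<in>B. \<Sum>m\<in>neighbours n \<inter> B. f n m)"
  have S: "S = (\<Sum>n\<in>B. \<Sum>m\<in>B. if m \<in> neighbours n then f n m else 0)"
    unfolding S_def by (rule sum.cong[OF refl]) (subst Int_commute, rule sum.inter_restrict[OF assms])
  also have "\<dots> = (\<Sum>m\<in>B. \<Sum>n\<in>B. if n \<in> neighbours m then - f m n else 0)"
    by (subst sum.swap) (intro sum.cong refl, auto simp: neighbours_sym f_def)
  also have "\<dots> = - S"
    unfolding S sum_negf[symmetric] by (intro sum.cong refl) auto
  finally have "S = 0" by simp
  moreover have "(\<Sum>n\<in>B. \<Sum>m\<in>neighbours n. f n m) = S + (\<Sum>n\<in>B. \<Sum>m\<in>neighbours n - B. f n m)"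
    unfolding S_def sum.distrib[symmetric]
    by (intro sum.cong refl sum.Int_Diff finite_neighbours)
  ultimately show ?thesis by (simp add: f_def)
qed

section \<open>Uniform bounds for square-summable curves\<close>

lemma in_l2_diff:
  assumes "in_l2 u" "in_l2 v"
  shows "in_l2 (\<lambda>n. u n - v n)"
proof -
  have "(\<lambda>n. 2 * (cmod (u n))\<^sup>2 + 2 * (cmod (v n))\<^sup>2) summable_on UNIV"
    using assms unfolding in_l2_def by (intro summable_on_add summable_on_cmult_right)
  moreover have "(cmod (u n - v n))\<^sup>2 \<le> 2 * (cmod (u n))\<^sup>2 + 2 * (cmod (v n))\<^sup>2" for n
  proof -
    have "(cmod (u n - v n))\<^sup>2 \<le> (cmod (u n) + cmod (v n))\<^sup>2"
      by (intro power_mono norm_triangle_ineq4) auto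
    also have "\<dots> \<le> 2 * (cmod (u n))\<^sup>2 + 2 * (cmod (v n))\<^sup>2"
      using sum_squares_bound[of "cmod (u n)" "cmod (v n)"] by (simp add: power2_sum)
    finally show ?thesis .
  qed
  ultimately show ?thesis
    unfolding in_l2_def by (rule summable_on_comparison_test) auto
qed

lemma cmod_le_l2_norm:
  assumes "in_l2 u"
  shows "cmod (u n) \<le> l2_norm u"
proof -
  have "(\<Sum>k\<in>{n}. (cmod (u k))\<^sup>2) \<le> (\<Sum>\<^sub>\<infinity>k. (cmod (u k))\<^sup>2)"
    using assms unfolding in_l2_def by (intro finite_sum_le_infsum) auto
  thus ?thesis unfolding l2_norm_def by (intro real_le_rsqrt) simp
qed

text \<open>Near each time \<open>s\<close> the norm of the difference from \<open>C s\<close> stays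
  below 1, which bounds all sites at once. Compactness of \<open>{0..t}\<close> leaves finitely many
  such neighbourhoods.\<close>

lemma l2_continuous_bounded:
  assumes "l2_continuous_on {0..} C"
  obtains B where "\<And>s n. s \<in> {0..t} \<Longrightarrow> cmod (C s n) \<le> B"
proof -
  have "\<exists>U. open U \<and> s \<in> U \<and> (\<forall>r\<in>U \<inter> {0..}. \<forall>n. cmod (C r n) \<le> l2_norm (C s) + 1)"
    if "s \<in> {0..t}" for s
  proof -
    have l2: "in_l2 (C r)" if "r \<ge> 0" for r using assms that by (auto simp: l2_continuous_on_def)
    have s: "0 \<le> s" using that by simp
    have "((\<lambda>r. l2_norm (\<lambda>n. C r n - C s n)) \<longlongrightarrow> 0) (at s within {0..})"
      using assms s by (auto simp: l2_continuous_on_def)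
    hence "eventually (\<lambda>r. l2_norm (\<lambda>n. C r n - C s n) < 1) (at s within {0..})"
      by (rule order_tendstoD) simp
    then obtain U where U: "open U" "s \<in> U"
      "\<And>r. r \<in> U \<Longrightarrow> r \<noteq> s \<Longrightarrow> r \<in> {0..} \<Longrightarrow> l2_norm (\<lambda>n. C r n - C s n) < 1"
      unfolding eventually_at_topological by blast
    \<comment> \<open>The filter \<open>at s within {0..}\<close> says nothing about
      \<open>s\<close> itself, hence the separate case \<open>r = s\<close>.\<close>
    have "cmod (C r n) \<le> l2_norm (C s) + 1" if r: "r \<in> U \<inter> {0..}" for r n
    proof (cases "r = s")
      case True
      with cmod_le_l2_norm[OF l2[OF s], of n] show ?thesis by simp
    next
      case False
      have "cmod (C r n) \<le> cmod (C s n) + cmod (C r n - C s n)"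
        using norm_triangle_ineq[of "C s n" "C r n - C s n"] by simp
      also have "\<dots> \<le> l2_norm (C s) + l2_norm (\<lambda>n. C r n - C s n)"
        using r cmod_le_l2_norm[OF in_l2_diff[OF l2 l2], of r s n] s
        by (intro add_mono cmod_le_l2_norm[OF l2[OF s]]) auto
      also have "\<dots> \<le> l2_norm (C s) + 1" using U(3)[of r] r False by auto
      finally show ?thesis .
    qed
    with U show ?thesis by blast
  qed
  then obtain U where U: "\<And>s. s \<in> {0..t} \<Longrightarrow> open (U s) \<and> s \<in> U s \<and>
      (\<forall>r\<in>U s \<inter> {0..}. \<forall>n. cmod (C r n) \<le> l2_norm (C s) + 1)" by metis
  obtain T where T: "T \<subseteq> {0..t}" "finite T" "{0..t} \<subseteq> (\<Union>s\<in>T. U s)"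
    by (rule compactE_image[of "{0..t}" "{0..t}" U]) (use U in auto)
  \<comment> \<open>The sum over the finite subcover replaces a maximum.\<close>
  have "cmod (C r n) \<le> (\<Sum>s\<in>T. l2_norm (C s)) + 1" if r: "r \<in> {0..t}" for r n
  proof -
    obtain s where s: "s \<in> T" "r \<in> U s" using T(3) r by blast
    have "l2_norm (C s) \<le> (\<Sum>s\<in>T. l2_norm (C s))"
      by (rule member_le_sum[OF s(1) _ T(2)]) (auto simp: l2_norm_def intro: infsum_nonneg)
    moreover have "cmod (C r n) \<le> l2_norm (C s) + 1"
      using U[of s] s T(1) r by (metis IntI atLeastAtMost_iff atLeast_iff subsetD)
    ultimately show ?thesis by linarith
  qed
  thus ?thesis by (rule that)
qed

section \<open>Duhamel's formula at the origin\<close>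

text \<open>Since \<open>2 * N + 1 \<le> 3 * 2 ^ N\<close>, the volume is at most
  \<open>27 * 8 ^ N\<close>. This turns the error into terms of the exponential series at
  \<open>8 * X\<close>.\<close>

lemma box_error_tendsto_0:
  fixes X :: real
  assumes "0 \<le> X"
  shows "(\<lambda>N. (2 * real N + 1) ^ 3 * (X ^ N / fact N + X ^ Suc N / fact (Suc N))) \<longlonglongrightarrow> 0"
proof (rule tendsto_sandwich[OF _ _ tendsto_const])
  have lim: "(\<lambda>N. (8 * X) ^ N / fact N) \<longlonglongrightarrow> 0"
    using summable_LIMSEQ_zero[OF summable_exp[of "8 * X"]] by (simp add: divide_inverse mult.commute)
  from tendsto_mult_left[OF tendsto_add[OF lim LIMSEQ_Suc[OF lim]], of 27]
  show "(\<lambda>N. 27 * ((8 * X) ^ N / fact N + (8 * X) ^ Suc N / fact (Suc N))) \<longlonglongrightarrow> 0" by simp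
  show "\<forall>\<^sub>F N in sequentially. (2 * real N + 1) ^ 3 * (X ^ N / fact N + X ^ Suc N / fact (Suc N))
      \<le> 27 * ((8 * X) ^ N / fact N + (8 * X) ^ Suc N / fact (Suc N))"
  proof (rule always_eventually, rule allI)
    fix N
    have "real N \<le> 2 ^ N" "(1::real) \<le> 2 ^ N" by (simp_all add: less_imp_le)
    hence "2 * real N + 1 \<le> 3 * 2 ^ N" by linarith
    hence "(2 * real N + 1) ^ 3 \<le> (3 * 2 ^ N) ^ 3" by (intro power_mono) auto
    also have "\<dots> = 27 * 8 ^ N" by (simp add: power_mult_distrib power_mult[symmetric] mult.commute[of N]) (simp add: power_mult)
    finally have c: "(2 * real N + 1) ^ 3 \<le> 27 * (8::real) ^ N" .
    have "(2 * real N + 1) ^ 3 * (X ^ N / fact N + X ^ Suc N / fact (Suc N))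
        \<le> 27 * 8 ^ N * (X ^ N / fact N + X ^ Suc N / fact (Suc N))"
      using assms c by (intro mult_right_mono) auto
    also have "\<dots> = 27 * (8 ^ N * X ^ N / fact N + 8 ^ N * X ^ Suc N / fact (Suc N))"
      by (simp only: distrib_left mult.assoc times_divide_eq_right)
    also have "\<dots> \<le> 27 * (8 ^ N * X ^ N / fact N + 8 ^ Suc N * X ^ Suc N / fact (Suc N))"
      using assms by (intro mult_left_mono add_left_mono divide_right_mono mult_right_mono) auto
    finally show "(2 * real N + 1) ^ 3 * (X ^ N / fact N + X ^ Suc N / fact (Suc N))
      \<le> 27 * ((8 * X) ^ N / fact N + (8 * X) ^ Suc N / fact (Suc N))"
      by (simp only: power_mult_distrib)
  qed
  show "\<forall>\<^sub>F N in sequentially. 0 \<le> (2 * real N + 1) ^ 3 * (X ^ N / fact N + X ^ Suc N / fact (Suc N))"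
    using assms by simp
qed

text \<open>The pairing \<open>\<phi>\<close> of the time-reversed Green's function with the
  solution over a box is differentiated in \<open>s\<close>. Only the impurity and the edges leaving
  the box survive, and the latter vanish as the box grows.\<close>

lemma dnls_duhamel:
  assumes V: "V > 0" and F: "continuous_on UNIV F" and sol: "dnls_solution V chi F C" and t: "t \<ge> 0"
  shows "((\<lambda>s. \<i> * of_real chi * green V (0, 0, 0) (t - s) * F (C s (0, 0, 0)))
    has_integral C t (0, 0, 0) - green V (0, 0, 0) t) {0..t}"
proof -
  define o3 :: site where "o3 = (0, 0, 0)"
  define X where "X = V * t"
  have X: "0 \<le> X" using V t by (simp add: X_def)
  define h where "h s = \<i> * of_real chi * green V o3 (t - s) * F (C s o3)" for s
  define D where "D s n = - \<i> * (of_real V * (\<Sum>m\<in>neighbours n. C s m) - of_real chi * delta0 n * F (C s n))" for s n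
  have dC: "((\<lambda>s. C s n) has_vector_derivative D s n) (at s within {0..})" if s: "s \<ge> 0" for s n
  proof -
    obtain E where E: "((\<lambda>s. C s n) has_vector_derivative E) (at s within {0..})"
      "\<i> * E = of_real V * (\<Sum>m\<in>neighbours n. C s m) - of_real chi * delta0 n * F (C s n)"
      using sol s unfolding dnls_solution_def by blast
    have "E = - \<i> * (\<i> * E)" by (simp add: mult.assoc[symmetric])
    also have "\<dots> = D s n" unfolding E(2) D_def ..
    finally show ?thesis using E(1) by simp
  qed
  \<comment> \<open>Time reversal flips the sign of the hopping term, so that it can cancel against
    that of \<open>C\<close>.\<close>
  have dG: "((\<lambda>s. green V n (t - s)) has_vector_derivative
      \<i> * of_real V * (\<Sum>m\<in>neighbours n. green V m (t - s))) (at s within S)" for n s S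
  proof -
    have "((\<lambda>s. t - s) has_vector_derivative - 1) (at s within S)"
      by (auto intro!: derivative_eq_intros)
    from vector_diff_chain_within[OF this green_deriv] show ?thesis
      by (simp add: o_def)
  qed
  have dC': "((\<lambda>s. C s n) has_vector_derivative D s n) (at s within {0..t})" if "s \<in> {0..t}" for s n
    by (rule has_vector_derivative_within_subset[OF dC]) (use that in auto)
  have contC: "continuous_on {0..t} (\<lambda>s. C s o3)"
    unfolding continuous_on_eq_continuous_within by (blast intro: has_vector_derivative_continuous dC')
  have contG: "continuous_on {0..t} (\<lambda>s. green V o3 (t - s))"
    unfolding continuous_on_eq_continuous_within by (blast intro: has_vector_derivative_continuous dG)
  have "continuous_on {0..t} h"
    unfolding h_def by (intro continuous_intros contG continuous_on_compose2[OF F contC]) auto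
  hence hI: "(h has_integral integral {0..t} h) {0..t}"
    by (intro integrable_integral integrable_continuous_real)
  obtain B where B: "\<And>s n. s \<in> {0..t} \<Longrightarrow> cmod (C s n) \<le> B"
    using l2_continuous_bounded[of C t] sol unfolding dnls_solution_def by metis
  have B0: "0 \<le> B" using order_trans[OF norm_ge_zero B[of 0 o3]] t by simp
  define K where "K = exp (X\<^sup>2) * (exp X * exp (X\<^sup>2))\<^sup>2"
  define e where "e N = X ^ N / fact N + X ^ Suc N / fact (Suc N)" for N
  define \<epsilon> where "\<epsilon> N = (2 * real N + 1) ^ 3 * e N" for N
  \<comment> \<open>The bound multiplies the number of sites, six edges per site, the coupling
    \<open>V\<close>, an edge term of size \<open>B * K * e N\<close>, and the length
    \<open>t\<close> of the interval.\<close>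
  have bound: "cmod (C t o3 - green V o3 t - integral {0..t} h) \<le> 6 * V * B * K * \<epsilon> N * t" for N
  proof -
    define \<phi> where "\<phi> s = (\<Sum>n\<in>box N. green V n (t - s) * C s n)" for s
    define R where "R s = \<i> * of_real V * (\<Sum>n\<in>box N. \<Sum>m\<in>neighbours n - box N.
        green V m (t - s) * C s n - green V n (t - s) * C s m)" for s
    have "(\<phi> has_vector_derivative h s + R s) (at s within {0..t})" if s: "s \<in> {0..t}" for s
    proof -
      have d: "(\<phi> has_vector_derivative (\<Sum>n\<in>box N. green V n (t - s) * D s n +
          \<i> * of_real V * (\<Sum>m\<in>neighbours n. green V m (t - s)) * C s n)) (at s within {0..t})"
        unfolding \<phi>_def by (intro has_vector_derivative_sum has_vector_derivative_mult dG dC' s)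
      \<comment> \<open>The first summand is the impurity; the second has the antisymmetric form of
        \<open>discrete_green_identity\<close>.\<close>
      have "green V n (t - s) * D s n + \<i> * of_real V * (\<Sum>m\<in>neighbours n. green V m (t - s)) * C s n
        = \<i> * of_real chi * (delta0 n * (green V n (t - s) * F (C s n)))
        + \<i> * of_real V * (\<Sum>m\<in>neighbours n. green V m (t - s) * C s n - green V n (t - s) * C s m)" for n
        by (simp add: D_def sum_subtractf sum_distrib_left[symmetric] sum_distrib_right[symmetric] algebra_simps)
      hence "(\<Sum>n\<in>box N. green V n (t - s) * D s n +
          \<i> * of_real V * (\<Sum>m\<in>neighbours n. green V m (t - s)) * C s n)
        = \<i> * of_real chi * (\<Sum>n\<in>box N. delta0 n * (green V n (t - s) * F (C s n)))
        + \<i> * of_real V * (\<Sum>n\<in>box N. \<Sum>m\<in>neighbours n. green V m (t - s) * C s n - green V n (t - s) * C s m)"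
        by (simp add: sum.distrib sum_distrib_left[symmetric])
      also have "(\<Sum>n\<in>box N. delta0 n * (green V n (t - s) * F (C s n))) = green V o3 (t - s) * F (C s o3)"
      proof -
        have "(\<Sum>n\<in>box N. delta0 n * (green V n (t - s) * F (C s n)))
          = (\<Sum>n\<in>box N. if n = o3 then green V n (t - s) * F (C s n) else 0)"
          by (intro sum.cong refl) (simp add: delta0_def o3_def)
        thus ?thesis using zero_in_box[of N] by (simp add: finite_box o3_def[symmetric])
      qed
      also have "\<i> * of_real V * (\<Sum>n\<in>box N. \<Sum>m\<in>neighbours n. green V m (t - s) * C s n - green V n (t - s) * C s m) = R s"
        unfolding R_def discrete_green_identity[OF finite_box, of "\<lambda>n. green V n (t - s)" "C s" N] ..
      finally show ?thesis using d by (simp add: h_def mult.assoc)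
    qed
    hence "((\<lambda>s. h s + R s) has_integral \<phi> t - \<phi> 0) {0..t}"
      by (rule fundamental_theorem_of_calculus[OF t])
    from has_integral_diff[OF this hI]
    have RI: "(R has_integral \<phi> t - \<phi> 0 - integral {0..t} h) (cbox 0 t)" by simp
    \<comment> \<open>At \<open>s = t\<close> Green's function is \<open>delta0\<close>, and at
      \<open>s = 0\<close> the solution is; so each endpoint keeps only the site
      \<open>o3\<close>.\<close>
    have \<phi>t: "\<phi> t = C t o3"
    proof -
      have "\<phi> t = (\<Sum>n\<in>box N. if n = o3 then C t n else 0)"
        unfolding \<phi>_def by (intro sum.cong refl) (simp add: green_at_0 delta0_def o3_def del: green.simps)
      thus ?thesis using zero_in_box[of N] by (simp add: finite_box o3_def[symmetric])
    qed
    have \<phi>0: "\<phi> 0 = green V o3 t"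
    proof -
      have "C 0 n = delta0 n" for n using sol unfolding dnls_solution_def by blast
      hence "\<phi> 0 = (\<Sum>n\<in>box N. if n = o3 then green V n t else 0)"
        unfolding \<phi>_def by (intro sum.cong refl) (simp add: delta0_def o3_def del: green.simps)
      thus ?thesis using zero_in_box[of N] by (simp add: finite_box o3_def[symmetric])
    qed
    have "cmod (R s) \<le> 6 * V * B * K * \<epsilon> N" if s: "s \<in> cbox 0 t" for s
    proof -
      have s': "s \<in> {0..t}" using s by simp
      have tau: "\<bar>V * (t - s)\<bar> \<le> X" using s' V by (auto simp: X_def abs_mult intro!: mult_left_mono)
      have edge: "cmod (green V m (t - s) * C s n - green V n (t - s) * C s m) \<le> B * K * e N"
        if "n \<in> box N" "m \<in> neighbours n - box N" for n m
      proof -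
        have m: "m \<in> neighbours n" "m \<notin> box N" using that by auto
        note b = box_boundary[OF that(1) m tau]
        have "cmod (green V m (t - s) * C s n - green V n (t - s) * C s m)
          \<le> cmod (green V m (t - s)) * cmod (C s n) + cmod (green V n (t - s)) * cmod (C s m)"
          using norm_triangle_ineq4[of "green V m (t - s) * C s n" "green V n (t - s) * C s m"] by (simp add: norm_mult)
        also have "\<dots> \<le> X ^ Suc N / fact (Suc N) * exp (X\<^sup>2) * (exp X * exp (X\<^sup>2))\<^sup>2 * B
            + X ^ N / fact N * exp (X\<^sup>2) * (exp X * exp (X\<^sup>2))\<^sup>2 * B"
          by (intro add_mono mult_mono b B[OF s'])
             (use X in \<open>auto intro!: divide_nonneg_nonneg mult_nonneg_nonneg simp del: fact_Suc\<close>)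
        also have "\<dots> = B * K * e N" unfolding K_def e_def
          by (simp only: distrib_left distrib_right mult_ac add_ac)
        finally show ?thesis .
      qed
      have e0: "0 \<le> B * K * e N" using X B0
        unfolding K_def e_def by (intro mult_nonneg_nonneg add_nonneg_nonneg divide_nonneg_nonneg) auto
      have inner: "cmod (\<Sum>m\<in>neighbours n - box N. green V m (t - s) * C s n - green V n (t - s) * C s m)
         \<le> 6 * (B * K * e N)" if n: "n \<in> box N" for n
      proof -
        have "card (neighbours n - box N) \<le> 6"
          using card_mono[OF finite_neighbours, of "neighbours n - box N" n] by (simp add: card_neighbours)
        hence "of_nat (card (neighbours n - box N)) * (B * K * e N) \<le> 6 * (B * K * e N)"
          using e0 by (intro mult_right_mono) auto
        moreover have "cmod (\<Sum>m\<in>neighbours n - box N. green V m (t - s) * C s n - green V n (t - s) * C s m)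
            \<le> of_nat (card (neighbours n - box N)) * (B * K * e N)"
          by (rule sum_norm_bound) (rule edge[OF n])
        ultimately show ?thesis by (rule order_trans[rotated])
      qed
      have "cmod (\<Sum>n\<in>box N. \<Sum>m\<in>neighbours n - box N.
          green V m (t - s) * C s n - green V n (t - s) * C s m) \<le> of_nat (card (box N)) * (6 * (B * K * e N))"
        by (rule sum_norm_bound) (rule inner)
      hence "V * cmod (\<Sum>n\<in>box N. \<Sum>m\<in>neighbours n - box N.
          green V m (t - s) * C s n - green V n (t - s) * C s m) \<le> V * (of_nat (card (box N)) * (6 * (B * K * e N)))"
        using V by (intro mult_left_mono) auto
      also have "\<dots> = 6 * V * B * K * \<epsilon> N" by (simp add: card_box \<epsilon>_def add.commute)
      finally show ?thesis using V by (simp add: R_def norm_mult)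
    qed
    moreover have "0 \<le> 6 * V * B * K * \<epsilon> N"
      using X B0 V unfolding K_def \<epsilon>_def e_def
      by (intro mult_nonneg_nonneg add_nonneg_nonneg divide_nonneg_nonneg) auto
    ultimately show ?thesis
      using has_integral_bound[OF _ RI] t by (simp add: \<phi>t \<phi>0)
  qed
  have "(\<lambda>N. 6 * V * B * K * \<epsilon> N * t) \<longlonglongrightarrow> 6 * V * B * K * 0 * t"
    unfolding \<epsilon>_def e_def by (intro tendsto_intros box_error_tendsto_0 X)
  hence "cmod (C t o3 - green V o3 t - integral {0..t} h) \<le> 6 * V * B * K * 0 * t"
    by (rule LIMSEQ_le_const) (use bound in auto)
  hence "C t o3 - green V o3 t = integral {0..t} h" by simp
  with hI show ?thesis by (simp add: h_def[abs_def] o3_def del: green.simps)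
qed

section \<open>Decay for small coupling\<close>

text \<open>For \<open>V * t \<ge> 1\<close> the Bessel energy gives the decay. For smaller
  \<open>t\<close> the weight \<open>1 + t\<close> is bounded and the power series suffices.\<close>

lemma green_origin_decay:
  assumes V: "V > 0"
  obtains A where "1 \<le> A" "\<And>t. t \<ge> 0 \<Longrightarrow> cmod (green V (0, 0, 0) t) \<le> A / sqrt (1 + t) ^ 3"
proof -
  \<comment> \<open>One summand for each regime, and 1 to ensure that the resulting \<open>A\<close>
    is at least 1.\<close>
  define Q where "Q = (1 + V) / (2 * V) * bessel_energy 1 + (exp 1)\<^sup>2 * (1 + 1 / V) + 1"
  have E: "0 \<le> bessel_energy 1"
    using order_trans[OF _ bessel_energy_ge[of 1]] by simp
  have Q: "1 \<le> Q" using V E by (simp add: Q_def)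
  have b: "(bessel 0 (V * t))\<^sup>2 * (1 + t) \<le> Q" if t: "t \<ge> 0" for t
  proof (cases "V * t \<ge> 1")
    case True
    have "1 + t \<le> (1 + V) * t" using True by (simp add: algebra_simps)
    hence "(bessel 0 (V * t))\<^sup>2 * (1 + t) \<le> (bessel 0 (V * t))\<^sup>2 * ((1 + V) * t)"
      by (intro mult_left_mono) auto
    also have "\<dots> = (1 + V) / (2 * V) * (2 * (V * t) * (bessel 0 (V * t))\<^sup>2)"
      using V by (simp add: field_simps)
    also have "\<dots> \<le> (1 + V) / (2 * V) * bessel_energy 1"
      using bessel_0_sq_bound[OF True] V by (intro mult_left_mono) auto
    also have "\<dots> \<le> Q" using V by (simp add: Q_def)
    finally show ?thesis .
  next
    case False
    have "\<bar>bessel 0 (V * t)\<bar> \<le> exp ((V * t)\<^sup>2)" using bessel_bound[of 0 "V * t"] by simp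
    also have "\<dots> \<le> exp 1" using False t V by (simp add: power_le_one)
    finally have "(bessel 0 (V * t))\<^sup>2 \<le> (exp 1)\<^sup>2" by (simp add: abs_le_square_iff[symmetric])
    moreover have "t \<le> 1 / V" using False V by (simp add: field_simps)
    ultimately have "(bessel 0 (V * t))\<^sup>2 * (1 + t) \<le> (exp 1)\<^sup>2 * (1 + 1 / V)"
      using t by (intro mult_mono) auto
    also have "\<dots> \<le> Q" using V E by (simp add: Q_def)
    finally show ?thesis .
  qed
  show ?thesis
  proof (rule that[of "sqrt Q ^ 3"])
    show "1 \<le> sqrt Q ^ 3" using Q by (intro one_le_power) simp
    fix t :: real assume t: "t \<ge> 0"
    have "(bessel 0 (V * t))\<^sup>2 \<le> Q / (1 + t)" using b[OF t] t by (simp add: field_simps)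
    hence "\<bar>bessel 0 (V * t)\<bar> \<le> sqrt Q / sqrt (1 + t)"
      using real_sqrt_le_mono by (fastforce simp: real_sqrt_divide)
    hence "\<bar>bessel 0 (V * t)\<bar> ^ 3 \<le> (sqrt Q / sqrt (1 + t)) ^ 3"
      by (intro power_mono) auto
    thus "cmod (green V (0, 0, 0) t) \<le> sqrt Q ^ 3 / sqrt (1 + t) ^ 3"
      by (simp add: green1_def norm_mult power3_eq_cube)
  qed
qed

section \<open>Integrals and products of the decay kernel\<close>

lemma DERIV_two_div_sqrt:
  assumes "0 < x"
  shows "((\<lambda>x. 2 / sqrt x) has_real_derivative - (1 / sqrt x ^ 3)) (at x)"
proof -
  have "((\<lambda>x. 2 / sqrt x) has_real_derivative
      (0 * sqrt x - 2 * (inverse (sqrt x) / 2)) / (sqrt x * sqrt x)) (at x)"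
    by (rule DERIV_divide[OF DERIV_const DERIV_real_sqrt]) (use assms in auto)
  also have "(0 * sqrt x - 2 * (inverse (sqrt x) / 2)) / (sqrt x * sqrt x) = - (1 / sqrt x ^ 3)"
    by (simp add: power3_eq_cube inverse_eq_divide del: real_sqrt_mult_self)
  finally show ?thesis .
qed

lemma integral_decay_kernel:
  assumes "0 \<le> t"
  shows "(\<lambda>s. 1 / sqrt (1 + s) ^ 3) integrable_on {0..t}" (is ?A)
    and "integral {0..t} (\<lambda>s. 1 / sqrt (1 + s) ^ 3) \<le> 2" (is ?B)
    and "(\<lambda>s. 1 / sqrt (1 + (t - s)) ^ 3) integrable_on {0..t}" (is ?C)
    and "integral {0..t} (\<lambda>s. 1 / sqrt (1 + (t - s)) ^ 3) \<le> 2" (is ?D)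
proof -
  have "((\<lambda>s. - (2 / sqrt (1 + s))) has_real_derivative 1 / sqrt (1 + s) ^ 3) (at s within {0..t})"
    if "s \<in> {0..t}" for s
  proof -
    have d: "((\<lambda>s. 1 + s) has_real_derivative 1) (at s within {0..t})"
      by (auto intro!: derivative_eq_intros)
    have "((\<lambda>s. 2 / sqrt (1 + s)) has_real_derivative - (1 / sqrt (1 + s) ^ 3) * 1) (at s within {0..t})"
      by (rule DERIV_chain2[of "\<lambda>x. 2 / sqrt x", OF DERIV_two_div_sqrt d]) (use that in simp)
    from DERIV_minus[OF this] show ?thesis by (simp only: mult_1_right minus_minus)
  qed
  from fundamental_theorem_of_calculus[OF assms this[unfolded has_real_derivative_iff_has_vector_derivative]]
  have "((\<lambda>s. 1 / sqrt (1 + s) ^ 3) has_integral 2 - 2 / sqrt (1 + t)) {0..t}" by simp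
  from has_integral_integrable[OF this] integral_unique[OF this] assms show ?A ?B by simp_all
  have "((\<lambda>s. 2 / sqrt (1 + (t - s))) has_real_derivative 1 / sqrt (1 + (t - s)) ^ 3) (at s within {0..t})"
    if "s \<in> {0..t}" for s
  proof -
    have d: "((\<lambda>s. 1 + (t - s)) has_real_derivative - 1) (at s within {0..t})"
      by (auto intro!: derivative_eq_intros)
    have "((\<lambda>s. 2 / sqrt (1 + (t - s))) has_real_derivative - (1 / sqrt (1 + (t - s)) ^ 3) * - 1)
        (at s within {0..t})"
      by (rule DERIV_chain2[of "\<lambda>x. 2 / sqrt x", OF DERIV_two_div_sqrt d]) (use that in simp)
    thus ?thesis by (simp only: mult_1_right minus_minus mult_minus_left mult_minus_right)
  qed
  from fundamental_theorem_of_calculus[OF assms this[unfolded has_real_derivative_iff_has_vector_derivative]]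
  have "((\<lambda>s. 1 / sqrt (1 + (t - s)) ^ 3) has_integral 2 - 2 / sqrt (1 + t)) {0..t}" by simp
  from has_integral_integrable[OF this] integral_unique[OF this] assms show ?C ?D by simp_all
qed

text \<open>One of \<open>s\<close> and \<open>t - s\<close> is at least \<open>t / 2\<close>, and
  there the kernel is at most 2 sqrt 2, hence 3, times its value at \<open>t\<close>. Integrated
  over \<open>s\<close>, this bounds the convolution.\<close>

lemma decay_kernel_mult:
  assumes "0 \<le> s" "s \<le> t"
  shows "1 / sqrt (1 + (t - s)) ^ 3 * (1 / sqrt (1 + s) ^ 3)
    \<le> 3 / sqrt (1 + t) ^ 3 * (1 / sqrt (1 + s) ^ 3 + 1 / sqrt (1 + (t - s)) ^ 3)"
proof -
  have half: "1 / sqrt (1 + r) ^ 3 \<le> 3 / sqrt (1 + t) ^ 3" if "(1 + t) / 2 \<le> 1 + r" for r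
  proof -
    have pos: "0 < sqrt (1 + t)" using assms by simp
    have "sqrt 2 ^ 3 = 2 * sqrt 2" by (simp add: power3_eq_cube)
    moreover have "sqrt 2 \<le> 3 / 2" by (rule real_le_lsqrt) (auto simp: power2_eq_square)
    ultimately have "sqrt 2 ^ 3 \<le> 3" by linarith
    have "sqrt (1 + t) / sqrt 2 \<le> sqrt (1 + r)" using that by (simp add: real_sqrt_divide[symmetric])
    hence "(sqrt (1 + t) / sqrt 2) ^ 3 \<le> sqrt (1 + r) ^ 3" using pos by (intro power_mono) auto
    hence "1 / sqrt (1 + r) ^ 3 \<le> 1 / (sqrt (1 + t) / sqrt 2) ^ 3"
      using pos by (intro frac_le) simp_all
    also have "\<dots> = sqrt 2 ^ 3 / sqrt (1 + t) ^ 3" by (simp add: power_divide)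
    also have "\<dots> \<le> 3 / sqrt (1 + t) ^ 3"
      using \<open>sqrt 2 ^ 3 \<le> 3\<close> pos by (intro divide_right_mono) auto
    finally show ?thesis .
  qed
  define a b where "a = 1 / sqrt (1 + (t - s)) ^ 3" and "b = 1 / sqrt (1 + s) ^ 3"
  define c where "c = 3 / sqrt (1 + t) ^ 3"
  have [simp]: "0 \<le> a" "0 \<le> b" "0 \<le> c" using assms by (auto simp: a_def b_def c_def)
  have "a \<le> c \<or> b \<le> c"
    using half[of s] half[of "t - s"] by (cases "s \<le> t / 2") (auto simp: a_def b_def c_def)
  hence "a * b \<le> c * (b + a)"
  proof
    assume "a \<le> c"
    hence "a * b \<le> c * b" by (intro mult_right_mono) auto
    also have "\<dots> \<le> c * (b + a)" by (intro mult_left_mono) auto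
    finally show ?thesis .
  next
    assume "b \<le> c"
    hence "a * b \<le> a * c" by (intro mult_left_mono) auto
    also have "\<dots> \<le> c * (b + a)" by (simp add: algebra_simps)
    finally show ?thesis .
  qed
  thus ?thesis by (simp add: a_def b_def c_def)
qed

section \<open>Continuity argument and decay\<close>

text \<open>If the bound failed, there would be a first time \<open>s\<close> with
  \<open>f s \<ge> M\<close>. The hypothesis \<open>step\<close> holds up to that time and
  contradicts it.\<close>

lemma continuous_bootstrap:
  fixes f :: "real \<Rightarrow> real"
  assumes cont: "continuous_on {0..} f" and f0: "f 0 < M"
    and step: "\<And>t. t \<ge> 0 \<Longrightarrow> (\<And>s. s \<in> {0..t} \<Longrightarrow> f s \<le> M) \<Longrightarrow> f t < M"
    and t: "t \<ge> 0"
  shows "f t < M"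
proof (rule ccontr)
  assume "\<not> f t < M"
  define S where "S = {0..t} \<inter> f -` {M..}"
  have ct: "continuous_on {0..t} f" by (rule continuous_on_subset[OF cont]) auto
  have "closed S" unfolding S_def by (rule continuous_closed_preimage[OF ct]) auto
  hence "compact S" using compact_Int_closed[of "{0..t}" S] by (simp add: S_def Int_assoc[symmetric])
  moreover have "S \<noteq> {}" using \<open>\<not> f t < M\<close> t by (auto simp: S_def)
  ultimately obtain s where s: "s \<in> S" "\<And>r. r \<in> S \<Longrightarrow> s \<le> r"
    using compact_attains_inf[of S] by metis
  have s0: "0 \<le> s" "s \<le> t" "M \<le> f s" using s(1) by (auto simp: S_def)
  have lt: "f r < M" if "0 \<le> r" "r < s" for r
    using s(2)[of r] that s0 by (force simp: S_def)
  \<comment> \<open>The intermediate value theorem gives equality at the first time, so the weak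
    bound required by \<open>step\<close> also holds at the endpoint \<open>s\<close>.\<close>
  have "continuous_on {0..s} f" by (rule continuous_on_subset[OF cont]) auto
  then obtain r where r: "0 \<le> r" "r \<le> s" "f r = M"
    using IVT'[of f 0 M s] f0 s0 by auto
  with lt[of r] have "r = s" by force
  with r have "f s = M" by simp
  have "f s < M"
  proof (rule step[OF s0(1)])
    fix r assume "r \<in> {0..s}"
    thus "f r \<le> M" using lt[of r] \<open>f s = M\<close> by (cases "r = s") auto
  qed
  with \<open>f s = M\<close> show False by simp
qed

text \<open>The bootstrap is applied to \<open>f\<close>, the modulus at the origin divided by the
  kernel \<open>k\<close>. The linear part uses up \<open>A\<close> of the allowed
  \<open>2 * A\<close>, and smallness of \<open>chi\<close> keeps the Duhamel integral strictly
  below the other \<open>A\<close>.\<close>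

lemma dnls_small_coupling_decay:
  assumes V: "V > 0" and A: "1 \<le> A"
    and decay: "\<And>t. t \<ge> 0 \<Longrightarrow> cmod (green V (0, 0, 0) t) \<le> A / sqrt (1 + t) ^ 3"
    and F: "continuous_on UNIV F" and L: "\<And>z. cmod z \<le> 2 * A \<Longrightarrow> cmod (F z) \<le> L * cmod z"
    and chi: "0 < chi" and small: "24 * A * L * chi < 1" and L0: "0 \<le> L"
    and sol: "dnls_solution V chi F C"
  shows "((\<lambda>t. cmod (C t (0, 0, 0))) \<longlongrightarrow> 0) at_top"
proof -
  define u where "u t = C t (0, 0, 0)" for t
  define k where "k t = 1 / sqrt (1 + t) ^ 3" for t :: real
  have k0: "0 < k t" if "t \<ge> 0" for t using that by (simp add: k_def)
  have k1: "k t \<le> 1" if "t \<ge> 0" for t using that by (simp add: k_def one_le_power)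
  define f where "f t = cmod (u t) * sqrt (1 + t) ^ 3" for t
  have fk: "cmod (u t) = f t * k t" if "t \<ge> 0" for t using that by (simp add: f_def k_def)
  have "continuous_on {0..} u"
  proof -
    have "\<exists>D. (u has_vector_derivative D) (at t within {0..})" if "t \<ge> 0" for t
      using sol that unfolding dnls_solution_def u_def by blast
    thus ?thesis
      unfolding continuous_on_eq_continuous_within by (auto intro: has_vector_derivative_continuous)
  qed
  hence cont: "continuous_on {0..} f" unfolding f_def by (intro continuous_intros)
  have step: "f t < 2 * A" if t: "t \<ge> 0" and le: "\<And>s. s \<in> {0..t} \<Longrightarrow> f s \<le> 2 * A" for t
  proof -
    define g where "g s = A * (2 * A * L) * chi * (3 * k t * (k s + k (t - s)))" for s
    have int: "k integrable_on {0..t}" "(\<lambda>s. k (t - s)) integrable_on {0..t}"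
      "integral {0..t} k \<le> 2" "integral {0..t} (\<lambda>s. k (t - s)) \<le> 2"
      using integral_decay_kernel[OF t] by (simp_all add: k_def[abs_def])
    have gI: "(g has_integral A * (2 * A * L) * chi * (3 * k t * (integral {0..t} k + integral {0..t} (\<lambda>s. k (t - s))))) {0..t}"
      unfolding g_def by (intro has_integral_mult_right has_integral_add integrable_integral int)
    have bound: "cmod (\<i> * of_real chi * green V (0, 0, 0) (t - s) * F (u s)) \<le> g s" if s: "s \<in> {0..t}" for s
    proof -
      have us: "cmod (u s) \<le> 2 * A * k s"
        using le[OF s] k0[of s] s by (simp add: fk mult_right_mono)
      \<comment> \<open>As \<open>k \<le> 1\<close>, the value \<open>u s\<close> stays in the ball
        where \<open>L\<close> controls \<open>F\<close>.\<close>
      also have "\<dots> \<le> 2 * A * 1" using A k1[of s] s by (intro mult_left_mono) auto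
      finally have "cmod (F (u s)) \<le> L * cmod (u s)" using L by simp
      also have "\<dots> \<le> L * (2 * A * k s)" using us L0 by (intro mult_left_mono)
      finally have Fu: "cmod (F (u s)) \<le> L * (2 * A * k s)" .
      have G: "cmod (green V (0, 0, 0) (t - s)) \<le> A * k (t - s)"
        using decay[of "t - s"] s by (simp add: k_def del: green.simps)
      have "cmod (\<i> * of_real chi * green V (0, 0, 0) (t - s) * F (u s))
          = chi * (cmod (green V (0, 0, 0) (t - s)) * cmod (F (u s)))"
        using chi by (simp add: norm_mult del: green.simps)
      also have "\<dots> \<le> chi * ((A * k (t - s)) * (L * (2 * A * k s)))"
        using chi A k0[of "t - s"] s by (intro mult_left_mono mult_mono G Fu) auto
      also have "\<dots> = A * (2 * A * L) * chi * (k (t - s) * k s)" by (simp add: mult_ac)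
      also have "\<dots> \<le> A * (2 * A * L) * chi * (3 * k t * (k s + k (t - s)))"
        using decay_kernel_mult[of s t] s A L0 chi
        by (intro mult_left_mono) (auto simp: k_def)
      finally show ?thesis by (simp add: g_def)
    qed
    have hI: "((\<lambda>s. \<i> * of_real chi * green V (0, 0, 0) (t - s) * F (u s))
        has_integral u t - green V (0, 0, 0) t) {0..t}"
      using dnls_duhamel[OF V F sol t] by (simp add: u_def del: green.simps)
    have "cmod (u t - green V (0, 0, 0) t)
       \<le> A * (2 * A * L) * chi * (3 * k t * (integral {0..t} k + integral {0..t} (\<lambda>s. k (t - s))))"
      using integral_norm_bound_integral[OF has_integral_integrable[OF hI] has_integral_integrable[OF gI] bound]
      by (simp add: integral_unique[OF hI] integral_unique[OF gI] del: green.simps)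
    \<comment> \<open>Each integral is at most 2, hence the 4. With the 3 from
      \<open>decay_kernel_mult\<close> and the 2 of \<open>2 * A\<close> it makes the constant
      24.\<close>
    also have "\<dots> \<le> A * (2 * A * L) * chi * (3 * k t * 4)"
      using int(3,4) A L0 chi k0[OF t] by (intro mult_left_mono) auto
    also have "\<dots> = A * k t * (24 * A * L * chi)" by simp
    also have "\<dots> < A * k t * 1"
      using A k0[OF t] small by (intro mult_strict_left_mono) auto
    finally have "cmod (u t - green V (0, 0, 0) t) < A * k t" by simp
    moreover have "cmod (green V (0, 0, 0) t) \<le> A * k t"
      using decay[OF t] by (simp add: k_def del: green.simps)
    moreover have "cmod (u t) \<le> cmod (green V (0, 0, 0) t) + cmod (u t - green V (0, 0, 0) t)"
      using norm_triangle_ineq[of "green V (0, 0, 0) t" "u t - green V (0, 0, 0) t"] by (simp del: green.simps)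
    ultimately have "f t * k t < (2 * A) * k t" using fk[OF t] by linarith
    thus ?thesis using k0[OF t] by simp
  qed
  have "C 0 (0, 0, 0) = 1" using sol unfolding dnls_solution_def delta0_def by simp
  hence f0: "f 0 < 2 * A" using A by (simp add: f_def u_def)
  have "cmod (u t) \<le> 2 * A * k t" if "t \<ge> 0" for t
    using continuous_bootstrap[OF cont f0 step that] k0[OF that] by (simp add: fk[OF that])
  hence ev: "\<forall>\<^sub>F t in at_top. cmod (u t) \<le> 2 * A * k t"
    using eventually_ge_at_top[of 0] by (rule eventually_mono[rotated]) simp
  have "filterlim (\<lambda>t::real. sqrt (1 + t) ^ 3) at_top at_top"
    by (intro filterlim_pow_at_top filterlim_compose[OF sqrt_at_top] filterlim_tendsto_add_at_top[OF tendsto_const] filterlim_ident) auto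
  hence "(k \<longlongrightarrow> 0) at_top"
    unfolding k_def[abs_def] by (intro tendsto_divide_0[OF tendsto_const] filterlim_at_top_imp_at_infinity)
  from tendsto_mult_right_zero[OF this]
  have "((\<lambda>t. 2 * A * k t) \<longlongrightarrow> 0) at_top" .
  from tendsto_sandwich[OF _ ev tendsto_const this]
  show ?thesis by (simp add: u_def)
qed

section \<open>Continuity and growth of the two nonlinearities\<close>

lemma continuous_F_pow: "\<sigma> > 0 \<Longrightarrow> continuous_on UNIV (F_pow \<sigma>)"
  unfolding F_pow_def[abs_def] by (intro continuous_intros continuous_on_powr') auto

lemma continuous_F_sat: "continuous_on UNIV F_sat"
proof -
  have "1 + (cmod z)\<^sup>2 \<noteq> 0" for z by (metis add_pos_nonneg less_irrefl zero_le_power2 zero_less_one)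
  thus ?thesis unfolding F_sat_def[abs_def]
    by (intro continuous_intros) (simp only: of_real_eq_0_iff, blast)
qed

lemma F_pow_bound:
  assumes "\<sigma> > 0" "cmod z \<le> R"
  shows "cmod (F_pow \<sigma> z) \<le> R powr (2 * \<sigma>) * cmod z"
  unfolding F_pow_def norm_mult using assms by (intro mult_right_mono) (auto intro: powr_mono2)

lemma F_sat_bound: "cmod (F_sat z) \<le> cmod z"
proof -
  have p: "0 < 1 + (cmod z)\<^sup>2" by (metis add_pos_nonneg zero_le_power2 zero_less_one)
  have "cmod (F_sat z) = (cmod z)\<^sup>2 / (1 + (cmod z)\<^sup>2) * cmod z"
    using p unfolding F_sat_def norm_divide norm_mult norm_of_real by simp
  also have "\<dots> \<le> 1 * cmod z" using p by (intro mult_right_mono) auto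
  finally show ?thesis by simp
qed

text \<open>The quantifiers make the saturable threshold depend on \<open>V\<close> alone, while the
  power threshold is chosen after \<open>\<sigma>\<close>.\<close>

theorem mainTheorem1:
  fixes V :: real
  assumes "V > 0"
  shows "\<exists>chi_sat>0. \<forall>\<sigma>>0. \<exists>chi_pow>0.
      (\<forall>chi C. 0 < chi \<and> chi < chi_pow \<and> dnls_solution V chi (F_pow \<sigma>) C \<longrightarrow>
         ((\<lambda>t. cmod (C t (0, 0, 0))) \<longlongrightarrow> 0) at_top) \<and>
      (\<forall>chi C. 0 < chi \<and> chi < chi_sat \<and> dnls_solution V chi F_sat C \<longrightarrow>
         ((\<lambda>t. cmod (C t (0, 0, 0))) \<longlongrightarrow> 0) at_top) \<and>
      chi_pow < chi_sat"
proof -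
  obtain A where A: "1 \<le> A"
    "\<And>t. t \<ge> 0 \<Longrightarrow> cmod (green V (0, 0, 0) t) \<le> A / sqrt (1 + t) ^ 3"
    using green_origin_decay[OF assms] by blast
  \<comment> \<open>The smallness condition with \<open>L = 1\<close>, which
    \<open>F_sat_bound\<close> permits on the whole plane.\<close>
  define chi_sat where "chi_sat = 1 / (24 * A)"
  have chi_sat: "0 < chi_sat" using A(1) by (simp add: chi_sat_def)
  have sat: "((\<lambda>t. cmod (C t (0, 0, 0))) \<longlongrightarrow> 0) at_top"
    if "0 < chi" "chi < chi_sat" "dnls_solution V chi F_sat C" for chi C
  proof (rule dnls_small_coupling_decay[OF assms A continuous_F_sat _ that(1) _ _ that(3), of 1])
    show "24 * A * 1 * chi < 1" using that(2) A(1) by (simp add: chi_sat_def field_simps)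
  qed (simp_all add: F_sat_bound)
  have pow: "\<exists>chi_pow>0. (\<forall>chi C. 0 < chi \<and> chi < chi_pow \<and> dnls_solution V chi (F_pow \<sigma>) C \<longrightarrow>
      ((\<lambda>t. cmod (C t (0, 0, 0))) \<longlongrightarrow> 0) at_top) \<and> chi_pow < chi_sat" if \<sigma>: "\<sigma> > 0" for \<sigma>
  proof -
    define L where "L = (2 * A) powr (2 * \<sigma>)"
    have L: "0 < L" using A(1) by (simp add: L_def)
    \<comment> \<open>The second entry is the smallness condition for \<open>L\<close>, the growth
      factor on the ball of radius \<open>2 * A\<close>. The first forces the strict inequality
      between the thresholds.\<close>
    define chi_pow where "chi_pow = min (chi_sat / 2) (1 / (24 * A * L))"
    have "((\<lambda>t. cmod (C t (0, 0, 0))) \<longlongrightarrow> 0) at_top"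
      if "0 < chi" "chi < chi_pow" "dnls_solution V chi (F_pow \<sigma>) C" for chi C
    proof (rule dnls_small_coupling_decay[OF assms A continuous_F_pow[OF \<sigma>] _ that(1) _ _ that(3), of L])
      have "chi < 1 / (24 * A * L)" using that(2) by (simp add: chi_pow_def)
      thus "24 * A * L * chi < 1" using A(1) L by (simp add: field_simps)
    qed (use F_pow_bound[OF \<sigma>] L in \<open>auto simp: L_def\<close>)
    moreover have "0 < chi_pow" "chi_pow < chi_sat"
      using A(1) L chi_sat by (auto simp: chi_pow_def min_less_iff_disj)
    ultimately show ?thesis by (intro exI[of _ chi_pow] conjI allI impI) (elim conjE | assumption)+
  qed
  show ?thesis
  proof (rule exI[of _ chi_sat], rule conjI[OF chi_sat], rule allI, rule impI)
    fix \<sigma> :: real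
    assume "\<sigma> > 0"
    from pow[OF this] obtain chi_pow where p: "0 < chi_pow" "chi_pow < chi_sat"
      "\<forall>chi C. 0 < chi \<and> chi < chi_pow \<and> dnls_solution V chi (F_pow \<sigma>) C \<longrightarrow>
         ((\<lambda>t. cmod (C t (0, 0, 0))) \<longlongrightarrow> 0) at_top"
      by (elim exE conjE)
    show "\<exists>chi_pow>0.
      (\<forall>chi C. 0 < chi \<and> chi < chi_pow \<and> dnls_solution V chi (F_pow \<sigma>) C \<longrightarrow>
         ((\<lambda>t. cmod (C t (0, 0, 0))) \<longlongrightarrow> 0) at_top) \<and>
      (\<forall>chi C. 0 < chi \<and> chi < chi_sat \<and> dnls_solution V chi F_sat C \<longrightarrow>
         ((\<lambda>t. cmod (C t (0, 0, 0))) \<longlongrightarrow> 0) at_top) \<and>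
      chi_pow < chi_sat"
    proof (rule exI[of _ chi_pow], intro conjI p)
      show "\<forall>chi C. 0 < chi \<and> chi < chi_sat \<and> dnls_solution V chi F_sat C \<longrightarrow>
         ((\<lambda>t. cmod (C t (0, 0, 0))) \<longlongrightarrow> 0) at_top"
        by (intro allI impI, elim conjE) (rule sat)
    qed
  qed
qed

end
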